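(* The following is the complete list of normalised permutation polynomials of degree $6$ of $\mathbb{F}_{11}$: \begin{itemize} \item $x^6\pm 2x$, \item $x^6\pm 4x$, \item $x^6\pm a^2x^3+ax^2\pm 5x$, where $a\in\mathbb{F}_{11}$ is a nonzero square and the two signs are equal, \item $x^6\pm 4a^2x^3+ax^2\pm 4x$, where $a\in\mathbb{F}_{11}$ is a nonsquare and the two signs are equal. \end{itemize}
   Context: A polynomial $f\in\mathbb{F}_q[x]$ is a permutation polynomial of $\mathbb{F}_q$ if $c\mapsto f(c)$ is a permutation of $\mathbb{F}_q$. A permutation polynomial $f\in\mathbb{F}_q[x]$ is of normalised form if $f$ is monic, $f(0)=0$, and, when the degree $n$ of $f$ is not divisible by the characteristic of $\mathbb{F}_q$, the coefficient of $x^{n-1}$ is zero. (So for degree $6$ over $\mathbb{F}_{11}$ the coefficient of $x^5$ is zero.) *)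

theory Defs
  imports "HOL-Library.Cardinality" "HOL-Computational_Algebra.Computational_Algebra"
begin

(* A finite field of q elements is a type of class {finite, field} with CARD('a) = q. *)

definition permutation_polynomial :: "'a::{finite,field} poly \<Rightarrow> bool" where
  "permutation_polynomial f \<longleftrightarrow> bij (poly f)"

(* For degree f = 0 the truncated "degree f - 1" is never used, since CHAR('a) dvd 0. *)
definition normalised_form :: "'a::{finite,field} poly \<Rightarrow> bool" where
  "normalised_form f \<longleftrightarrow>
     lead_coeff f = 1 \<and> poly f 0 = 0 \<and>
     (\<not> CHAR('a) dvd degree f \<longrightarrow> coeff f (degree f - 1) = 0)"

end

theory Submission
  imports Defs "HOL-Number_Theory.Cong"
begin

text \<open>
  By Hermite's argument, if $f$ permutes a field with $q$ elements then $\sum_x f(x)^k = 0$ for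
  $0 < k < q - 1$, and this sum is minus the sum of the coefficients of $f^k$ at the positive
  multiples of $q - 1$. For $q = 11$ and $f = x^6 + bx^4 + cx^3 + dx^2 + ex$, the exponents
  $k = 2, 3, 4, 5$ suffice: $k = 2$ gives $b = 0$ and $k = 3$ gives $d^2 = -2ce$. If $d = 0$, then
  $k = 5$ forces $e^2 \in \{4, 5\}$ and $c = 0$. If $d \neq 0$, then $ce = 5d^2$, and substituting this
  into the relations for $k = 4, 5$ leaves two polynomial equations in $e^2$ and $\chi = d^5 = \pm 1$,
  whose only common root is $e^2 = 3$ for $\chi = 1$ and $e^2 = 5$ for $\chi = -1$. Conversely, the
  resulting polynomials are evaluated at all residues modulo 11.
\<close>

section \<open>Power sums over a finite field and Hermite's criterion\<close>

text \<open>Translation by 1 permutes the field, so the sum of all \<open>x + 1\<close> equals the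
  sum of all \<open>x\<close>; the difference is the cardinality.\<close>

lemma of_nat_CARD_eq_0: "of_nat CARD('a) = (0 :: 'a::{finite,ring_1})"
proof -
  have "(\<Sum>x\<in>UNIV. x + 1 :: 'a) = (\<Sum>x\<in>UNIV. x)"
    by (rule sum.reindex_bij_witness[of _ "\<lambda>y. y - 1" "\<lambda>x. x + 1"]) auto
  thus ?thesis
    by (simp add: sum.distrib)
qed

lemma finite_field_power_card_minus_1:
  fixes x :: "'a::{finite,field}"
  assumes "x \<noteq> 0"
  shows "x ^ (CARD('a) - 1) = 1"
proof -
  let ?U = "UNIV - {0 :: 'a}"
  have "(\<Prod>y\<in>?U. x * y) = (\<Prod>y\<in>?U. y)"
    by (rule prod.reindex_bij_witness[of _ "\<lambda>y. y / x" "\<lambda>y. x * y"]) (use assms in auto)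
  moreover have "(\<Prod>y\<in>?U. x * y) = x ^ (CARD('a) - 1) * (\<Prod>y\<in>?U. y)"
    by (simp add: prod.distrib card_Diff_singleton)
  moreover have "(\<Prod>y\<in>?U. y) \<noteq> 0"
    by simp
  ultimately show ?thesis
    by simp
qed

text \<open>In the divisible case every nonzero element contributes 1. Otherwise some
  \<open>g\<close> has \<open>g ^ j\<close> different from 1, and the substitution of
  \<open>g * x\<close> for \<open>x\<close> multiplies the sum by \<open>g ^ j\<close>, so it
  vanishes.\<close>

lemma sum_power_UNIV:
  assumes "j > 0"
  shows "(\<Sum>x\<in>UNIV. x ^ j) = (if (CARD('a) - 1) dvd j then -1 else (0 :: 'a::{finite,field}))"
proof (cases "(CARD('a) - 1) dvd j")
  case True
  have "x ^ j = 1" if "x \<noteq> 0" for x :: 'a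
    using True finite_field_power_card_minus_1[OF that] by (auto simp: power_mult elim: dvdE)
  hence "(\<Sum>x\<in>UNIV. x ^ j) = (\<Sum>x\<in>UNIV - {0 :: 'a}. 1 :: 'a)"
    using assms by (intro sum.mono_neutral_cong_right) auto
  also have "\<dots> = of_nat (CARD('a) - 1)"
    by (simp add: card_Diff_singleton)
  also have "\<dots> = of_nat (Suc (CARD('a) - 1)) - 1"
    by simp
  also have "Suc (CARD('a) - 1) = CARD('a)"
    by simp
  also have "of_nat CARD('a) - 1 = (-1 :: 'a)"
    by (simp add: of_nat_CARD_eq_0)
  finally show ?thesis
    using True by simp
next
  case False
  define r where "r = j mod (CARD('a) - 1)"
  have "card {0, 1 :: 'a} \<le> CARD('a)"
    by (intro card_mono) auto
  hence card: "CARD('a) \<ge> 2"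
    by simp
  have r: "0 < r" "r < CARD('a) - 1"
    using False card unfolding r_def by (auto simp: dvd_eq_mod_eq_0 intro!: mod_less_divisor)
  \<comment> \<open>The degree of this polynomial is too small for all nonzero elements to be roots,
    which yields \<open>g\<close>.\<close>
  let ?p = "monom 1 r - 1 :: 'a poly"
  have "coeff ?p r \<noteq> 0"
    using r by (simp add: coeff_1)
  hence "?p \<noteq> 0"
    by (metis coeff_0)
  moreover have "degree ?p \<le> r"
    by (rule degree_diff_le) (simp_all add: degree_monom_le)
  ultimately have "card {x. poly ?p x = 0} \<le> r"
    using card_poly_roots_bound[of ?p] by linarith
  also have "r < card (UNIV - {0 :: 'a})"
    using r by (simp add: card_Diff_singleton)
  finally have "\<not> UNIV - {0} \<subseteq> {x. poly ?p x = 0}"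
    using card_mono[of "{x. poly ?p x = 0}" "UNIV - {0}"] by auto
  then obtain g :: 'a where g: "g \<noteq> 0" "g ^ r \<noteq> 1"
    by (auto simp: poly_monom)
  have "g ^ j = g ^ (r + (CARD('a) - 1) * (j div (CARD('a) - 1)))"
    unfolding r_def by simp
  also have "\<dots> = g ^ r"
    unfolding power_add power_mult finite_field_power_card_minus_1[OF g(1)] by simp
  finally have "g ^ j \<noteq> 1"
    using g(2) by simp
  have "(\<Sum>x\<in>UNIV. x ^ j) = (\<Sum>x\<in>UNIV. (g * x) ^ j)"
    by (rule sum.reindex_bij_witness[of _ "\<lambda>y. g * y" "\<lambda>y. y / g"]) (use g(1) in auto)
  also have "\<dots> = g ^ j * (\<Sum>x\<in>UNIV. x ^ j)"
    by (simp add: power_mult_distrib sum_distrib_left)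
  finally have "(\<Sum>x\<in>UNIV. x ^ j) = (0 :: 'a)"
    using \<open>g ^ j \<noteq> 1\<close> by simp
  thus ?thesis
    using False by simp
qed

lemma sum_poly_UNIV:
  fixes p :: "'a::{finite,field} poly"
  assumes "degree p \<le> n"
  shows "(\<Sum>x\<in>UNIV. poly p x) = - (\<Sum>j | j \<in> {1..n} \<and> (CARD('a) - 1) dvd j. coeff p j)"
proof -
  have *: "poly p x = (\<Sum>j\<le>n. coeff p j * x ^ j)" for x
    unfolding poly_altdef
    by (rule sum.mono_neutral_left) (use assms in \<open>auto simp: coeff_eq_0\<close>)
  have "(\<Sum>x\<in>UNIV. poly p x) = (\<Sum>j\<le>n. coeff p j * (\<Sum>x\<in>UNIV. x ^ j))"
    unfolding * by (subst sum.swap) (simp add: sum_distrib_left)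
  \<comment> \<open>The constant term drops out because the sum of \<open>x ^ 0\<close> is the
    cardinality, which is 0 in the field.\<close>
  also have "\<dots> = (\<Sum>j\<in>{1..n}. coeff p j * (\<Sum>x\<in>UNIV. x ^ j))"
    by (intro sum.mono_neutral_right) (auto simp: not_less_eq_eq of_nat_CARD_eq_0)
  also have "\<dots> = (\<Sum>j\<in>{1..n}. if (CARD('a) - 1) dvd j then - coeff p j else 0)"
    by (intro sum.cong) (auto simp: sum_power_UNIV)
  also have "\<dots> = (\<Sum>j | j \<in> {1..n} \<and> (CARD('a) - 1) dvd j. - coeff p j)"
    by (simp only: sum.inter_filter finite_atLeastAtMost)
  finally show ?thesis
    by (simp add: sum_negf)
qed

text \<open>Summing \<open>f ^ k\<close> over the field only reorders the sum of all
  \<open>y ^ k\<close>, which is 0 in this range of \<open>k\<close>.\<close>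

lemma permutation_polynomial_sum_coeff_power:
  fixes f :: "'a::{finite,field} poly"
  assumes "permutation_polynomial f" "0 < k" "k < CARD('a) - 1" "degree f * k \<le> n"
  shows "(\<Sum>j | j \<in> {1..n} \<and> (CARD('a) - 1) dvd j. coeff (f ^ k) j) = 0"
proof -
  have "degree (f ^ k) \<le> n"
    using degree_power_le[of f k] assms(4) by linarith
  moreover have "(\<Sum>x\<in>UNIV. poly (f ^ k) x) = (\<Sum>y\<in>UNIV. y ^ k)"
    using assms(1) unfolding permutation_polynomial_def poly_power
    by (rule sum.reindex_bij_betw)
  moreover have "\<dots> = 0"
    using assms(2,3) by (auto simp: sum_power_UNIV dest: dvd_imp_le)
  ultimately show ?thesis
    using sum_poly_UNIV[of "f ^ k" n] by simp
qed

section \<open>Evaluation of the listed sextics at the residues modulo 11\<close>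

text \<open>
  A constant rather than a local abbreviation, so that the simplifier instantiates the coefficients
  with numerals before it evaluates the list.
\<close>

definition sextic_distinct_mod_11 :: "nat \<Rightarrow> nat \<Rightarrow> nat \<Rightarrow> bool" where
  "sextic_distinct_mod_11 c d e \<longleftrightarrow>
     distinct (map (\<lambda>k. (k ^ 6 + c * k ^ 3 + d * k\<^sup>2 + e * k) mod 11) [0..<11])"

lemma upt_11: "[0..<11] = [0, 1, 2, 3, 4, 5, 6, 7, 8, 9, 10]"
  by (simp add: upt_rec)

text \<open>Here and below, \<open>t\<close> represents the sign: 10 stands for -1.\<close>

lemma sextic_distinct_mod_11_binomial:
  "\<forall>t\<in>{1, 10}. \<forall>u\<in>{2, 4}. sextic_distinct_mod_11 0 0 (t * u)"
  by (simp, simp add: sextic_distinct_mod_11_def upt_11)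

text \<open>By Euler's criterion, the condition on \<open>a ^ 5\<close> selects the nonzero squares;
  the value 10 in the next lemma selects the nonsquares.\<close>

lemma sextic_distinct_mod_11_square:
  "\<forall>t\<in>{1, 10}. \<forall>a\<in>set [0..<11]. a ^ 5 mod 11 = 1 \<longrightarrow> sextic_distinct_mod_11 (t * a\<^sup>2) a (t * 5)"
  unfolding upt_11 by (simp, simp add: sextic_distinct_mod_11_def upt_11)

lemma sextic_distinct_mod_11_nonsquare:
  "\<forall>t\<in>{1, 10}. \<forall>a\<in>set [0..<11]. a ^ 5 mod 11 = 10 \<longrightarrow> sextic_distinct_mod_11 (t * (4 * a\<^sup>2)) a (t * 4)"
  unfolding upt_11 by (simp, simp add: sextic_distinct_mod_11_def upt_11)

definition sextic_coeffs :: "'a::field \<Rightarrow> 'a \<Rightarrow> 'a \<Rightarrow> bool" where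
  "sextic_coeffs c d e \<longleftrightarrow>
     (c = 0 \<and> d = 0 \<and> (\<exists>s\<in>{1, -1}. e = s * 2 \<or> e = s * 4)) \<or>
     (\<exists>s\<in>{1, -1}. d \<noteq> 0 \<and> is_square d \<and> c = s * d\<^sup>2 \<and> e = s * 5) \<or>
     (\<exists>s\<in>{1, -1}. \<not> is_square d \<and> c = s * (4 * d\<^sup>2) \<and> e = s * 4)"

section \<open>Arithmetic and squares in the field with 11 elements\<close>

context
  assumes card: "CARD('a::{finite,field}) = 11"
begin

lemma CHAR_11: "CHAR('a) = 11"
proof -
  have "CHAR('a) dvd 11"
    by (simp flip: of_nat_eq_0_iff_char_dvd card add: of_nat_CARD_eq_0)
  moreover have "prime (11 :: nat)"
    by simp
  ultimately have "CHAR('a) = 1 \<or> CHAR('a) = 11"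
    by (meson prime_nat_iff)
  thus ?thesis
    using CHAR_not_1'[where ?'a = 'a] by auto
qed

text \<open>
  Identities modulo 11 are proved below as polynomial identities over the integers with an explicit
  multiple of 11, which this equation then cancels.
\<close>

lemma numeral_11: "(11 :: 'a) = 0"
  using of_nat_CHAR[where ?'a = 'a] by (simp add: CHAR_11)

lemma exists_of_nat: "\<exists>n<11. x = (of_nat n :: 'a)"
proof -
  have "inj_on (of_nat :: nat \<Rightarrow> 'a) {..<11}"
    by (auto simp: inj_on_def of_nat_eq_iff_cong_CHAR CHAR_11 cong_def)
  hence "of_nat ` {..<11} = (UNIV :: 'a set)"
    by (intro card_subset_eq) (auto simp: card_image card)
  thus ?thesis
    by (auto simp: set_eq_iff image_iff)
qed

text \<open>Multiplying \<open>x ^ 5 = 1\<close> by \<open>x\<close> gives \<open>x = x ^ 6\<close>,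
  so \<open>x ^ 3\<close> is a square root.\<close>

lemma power_5_is_square:
  assumes "x ^ 5 = (1 :: 'a)"
  shows "is_square x"
proof -
  have "x = (x ^ 3)\<^sup>2"
    using assms by algebra
  thus ?thesis
    by (rule is_nth_powerI)
qed

lemma is_square_power_5:
  assumes "is_square x" "x \<noteq> (0 :: 'a)"
  shows "x ^ 5 = 1"
proof -
  from assms obtain y where y: "x = y\<^sup>2"
    by (auto elim!: is_nth_powerE)
  hence "y \<noteq> 0"
    using assms by auto
  thus ?thesis
    using finite_field_power_card_minus_1[of y] by (simp add: y card flip: power_mult)
qed

lemma not_is_square_power_5:
  assumes "\<not> is_square (x :: 'a)"
  shows "x ^ 5 = -1"
proof -
  have "x \<noteq> 0"
    using assms by auto
  hence "(x ^ 5)\<^sup>2 = 1"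
    using finite_field_power_card_minus_1[of x] by (simp add: card flip: power_mult)
  thus ?thesis
    using assms power_5_is_square power2_eq_1_iff by blast
qed

section \<open>Necessary conditions on the coefficients\<close>

lemma sum_coeff_power:
  fixes f :: "'a poly"
  assumes "permutation_polynomial f" "degree f = 6" "0 < k" "k \<le> 5"
  shows "coeff (f ^ k) 10 + coeff (f ^ k) 20 + coeff (f ^ k) 30 = 0"
proof -
  from assms have "(\<Sum>j | j \<in> {1..30} \<and> (CARD('a) - 1) dvd j. coeff (f ^ k) j) = 0"
    by (intro permutation_polynomial_sum_coeff_power) (simp_all add: card)
  moreover
  have "{j \<in> {1..30}. (CARD('a) - 1) dvd j} = {10, 20, 30}"
    by (auto simp: card elim: dvdE)
  ultimately show ?thesis
    by (simp add: add.assoc)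
qed

lemma
  fixes b c d e :: 'a
  defines "f \<equiv> [:0, e, d, c, b, 0, 1:]"
  assumes "permutation_polynomial f"
  shows sextic_coeff_4_eq_0: "b = 0"
    and sextic_power_rel_3: "d\<^sup>2 = - 2 * c * e"
    and sextic_power_rel_4: "4 * d + d * e\<^sup>2 + 4 * c^3 * e + 6 * c\<^sup>2 * d\<^sup>2 = 0"
    and sextic_power_rel_5: "1 - e\<^sup>2 + 8 * c\<^sup>2 * d + 5 * e^4 + d^5 - 2 * c * d^3 * e + 8 * c\<^sup>2 * d * e\<^sup>2 = 0"
proof -
  have rel: "coeff (f ^ k) 10 + coeff (f ^ k) 20 + coeff (f ^ k) 30 = 0" if "0 < k" "k \<le> 5" for k
    using assms that by (intro sum_coeff_power) simp_all
  have f2: "f\<^sup>2 = [:0, 0, e\<^sup>2, 2*d*e, d\<^sup>2 + 2*c*e, 2*c*d + 2*b*e, c\<^sup>2 + 2*b*d, 2*e + 2*b*c,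
      2*d + b\<^sup>2, 2*c, 2*b, 0, 1:]"
    unfolding f_def power2_eq_square by (simp add: algebra_simps)
  have "2 * b = 0"
    using rel[of 2] unfolding f2 by (simp add: numeral_eq_Suc)
  \<comment> \<open>6 is the inverse of 2 modulo 11.\<close>
  have "b = 6 * (2 * b) - 11 * b"
    by algebra
  thus b: "b = 0"
    unfolding \<open>2 * b = 0\<close> numeral_11 by simp
  have f2: "f\<^sup>2 = [:0, 0, e\<^sup>2, 2*d*e, d\<^sup>2 + 2*c*e, 2*c*d, c\<^sup>2, 2*e, 2*d, 2*c, 0, 0, 1:]"
    unfolding f2 by (simp add: b)
  have f3: "f ^ 3 = [:0, 0, 0, e^3, 3*d*e\<^sup>2, 3*d\<^sup>2*e + 3*c*e\<^sup>2, d^3 + 6*c*d*e,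
       3*c*d\<^sup>2 + 3*c\<^sup>2*e, 3*c\<^sup>2*d + 3*e\<^sup>2, c^3 + 6*d*e, 3*d\<^sup>2 + 6*c*e, 6*c*d, 3*c\<^sup>2, 3*e, 3*d, 3*c, 0, 0, 1:]"
    \<comment> \<open>The inner product \<open>f * f\<close> is replaced by its known expansion
      before the remaining factor is unfolded.\<close>
    unfolding power3_eq_cube mult.assoc
    unfolding f2[unfolded power2_eq_square] unfolding f_def b
    by (simp add: algebra_simps power2_eq_square power3_eq_cube)
  have r3: "3 * d\<^sup>2 + 6 * c * e = 0"
    using rel[of 3] unfolding f3 by (simp add: numeral_eq_Suc)
  have "d\<^sup>2 = - 2 * c * e + 4 * (3 * d\<^sup>2 + 6 * c * e) - 11 * (d\<^sup>2 + 2 * c * e)"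
    by algebra
  thus d2: "d\<^sup>2 = - 2 * c * e"
    unfolding r3 numeral_11 by simp
  \<comment> \<open>With these factorisations, only the coefficients at 10, 20 and 30 are computed,
    as convolutions.\<close>
  have f4: "f ^ 4 = f\<^sup>2 * f\<^sup>2" and f5: "f ^ 5 = f\<^sup>2 * f ^ 3"
    by (simp_all flip: power_add)
  have "coeff (f ^ 4) 10 = 12 * d * e\<^sup>2 + 4 * c^3 * e + 6 * c\<^sup>2 * d\<^sup>2"
    unfolding f4 f2 by (simp add: coeff_mult numeral_eq_Suc) algebra
  moreover have "coeff (f ^ 4) 20 = 4 * d"
    unfolding f4 f2 by (simp add: coeff_mult numeral_eq_Suc)
  moreover have "coeff (f ^ 4) 30 = 0"
    unfolding f4 f2 by (simp add: coeff_mult numeral_eq_Suc)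
  ultimately have r4: "4 * d + 12 * d * e\<^sup>2 + 4 * c^3 * e + 6 * c\<^sup>2 * d\<^sup>2 = 0"
    using rel[of 4] by (simp add: algebra_simps)
  have "coeff (f ^ 5) 10 = 5 * e^4 + d^5 + 20 * c * d^3 * e + 30 * c\<^sup>2 * d * e\<^sup>2"
    unfolding f5 f2 f3 by (simp add: coeff_mult numeral_eq_Suc) algebra
  moreover have "coeff (f ^ 5) 20 = 10 * e\<^sup>2 + 30 * c\<^sup>2 * d"
    unfolding f5 f2 f3 by (simp add: coeff_mult numeral_eq_Suc)
  moreover have "coeff (f ^ 5) 30 = 1"
    unfolding f5 f2 f3 by (simp add: coeff_mult numeral_eq_Suc)
  ultimately have r5: "1 + 10 * e\<^sup>2 + 30 * c\<^sup>2 * d + 5 * e^4 + d^5 + 20 * c * d^3 * e + 30 * c\<^sup>2 * d * e\<^sup>2 = 0"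
    using rel[of 5] by (simp add: algebra_simps)
  have "4 * d + d * e\<^sup>2 + 4 * c^3 * e + 6 * c\<^sup>2 * d\<^sup>2 =
      4 * d + 12 * d * e\<^sup>2 + 4 * c^3 * e + 6 * c\<^sup>2 * d\<^sup>2 - 11 * (d * e\<^sup>2)"
    by algebra
  thus "4 * d + d * e\<^sup>2 + 4 * c^3 * e + 6 * c\<^sup>2 * d\<^sup>2 = 0"
    unfolding r4 numeral_11 by simp
  have "1 - e\<^sup>2 + 8 * c\<^sup>2 * d + 5 * e^4 + d^5 - 2 * c * d^3 * e + 8 * c\<^sup>2 * d * e\<^sup>2 =
      1 + 10 * e\<^sup>2 + 30 * c\<^sup>2 * d + 5 * e^4 + d^5 + 20 * c * d^3 * e + 30 * c\<^sup>2 * d * e\<^sup>2 -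
      11 * (e\<^sup>2 + 2 * c\<^sup>2 * d + 2 * c * d^3 * e + 2 * c\<^sup>2 * d * e\<^sup>2)"
    by algebra
  thus "1 - e\<^sup>2 + 8 * c\<^sup>2 * d + 5 * e^4 + d^5 - 2 * c * d^3 * e + 8 * c\<^sup>2 * d * e\<^sup>2 = 0"
    unfolding r5 numeral_11 by simp
qed

lemma numeral_eq_0_iff_11: "(numeral m :: 'a) = 0 \<longleftrightarrow> (11 :: nat) dvd numeral m"
  using of_nat_eq_0_iff_char_dvd[where ?'a = 'a, of "numeral m"] by (simp add: CHAR_11)

lemma sextic_coeffs_necessary:
  fixes c d e :: 'a
  assumes r3: "d\<^sup>2 = - 2 * c * e"
    and r4: "4 * d + d * e\<^sup>2 + 4 * c^3 * e + 6 * c\<^sup>2 * d\<^sup>2 = 0"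
    and r5: "1 - e\<^sup>2 + 8 * c\<^sup>2 * d + 5 * e^4 + d^5 - 2 * c * d^3 * e + 8 * c\<^sup>2 * d * e\<^sup>2 = 0"
  shows "sextic_coeffs c d e"
proof (cases "d = 0")
  case True
  have e: "1 - e\<^sup>2 + 5 * e^4 = 0"
    using r5 True by simp
  \<comment> \<open>Multiplying by 9, the inverse of 5, makes the quartic monic; it then splits with
    \<open>e\<^sup>2\<close> equal to 4 or to 16 = 5.\<close>
  have "(e - 2) * (e + 2) * (e - 4) * (e + 4) = 9 * (1 - e\<^sup>2 + 5 * e^4) - 11 * (4 * e^4 + e\<^sup>2 - 5)"
    by algebra
  also have "\<dots> = 0"
    unfolding e numeral_11 by simp
  finally have "e = 2 \<or> e = -2 \<or> e = 4 \<or> e = -4"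
    by (auto simp: eq_neg_iff_add_eq_0)
  moreover have "e \<noteq> 0"
    using e by auto
  hence "c = 0"
    using r3 True by (simp add: numeral_eq_0_iff_11)
  ultimately show ?thesis
    using True unfolding sextic_coeffs_def by auto
next
  case False
  \<comment> \<open>5 is the inverse of -2 modulo 11.\<close>
  have "c * e = 5 * d\<^sup>2 - 5 * (d\<^sup>2 - (- 2 * c * e)) + 11 * (c * e)"
    by algebra
  hence ce: "c * e = 5 * d\<^sup>2"
    unfolding r3 numeral_11 by simp
  \<comment> \<open>The factor \<open>e\<^sup>2\<close> pairs every \<open>c\<close> with an
    \<open>e\<close>, so that \<open>c * e = 5 * d\<^sup>2\<close> eliminates \<open>c\<close>. The
    same is done to the relation for exponent 5 below.\<close>
  have "d * (e^4 + 4 * e\<^sup>2 + d^5) =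
      e\<^sup>2 * (4 * d + d * e\<^sup>2 + 4 * c^3 * e + 6 * c\<^sup>2 * d\<^sup>2) - 11 * (59 * d^6)"
    using ce by algebra
  also have "\<dots> = 0"
    unfolding r4 numeral_11 by simp
  finally have r4': "e^4 + 4 * e\<^sup>2 + d^5 = 0"
    using False by simp
  have "5 * e^6 - e^4 + e\<^sup>2 + 2 * d^5 + 4 * d^5 * e\<^sup>2 =
      e\<^sup>2 * (1 - e\<^sup>2 + 8 * c\<^sup>2 * d + 5 * e^4 + d^5 - 2 * c * d^3 * e + 8 * c\<^sup>2 * d * e\<^sup>2)
      - 11 * (18 * d^5 + 17 * d^5 * e\<^sup>2)"
    using ce by algebra
  also have "\<dots> = 0"
    unfolding r5 numeral_11 by simp
  finally have r5': "5 * e^6 - e^4 + e\<^sup>2 + 2 * d^5 + 4 * d^5 * e\<^sup>2 = 0" .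
  show ?thesis
  proof (cases "is_square d")
    case True
    hence chi: "d ^ 5 = 1"
      using False by (rule is_square_power_5)
    \<comment> \<open>As polynomials in \<open>e\<^sup>2\<close>, \<open>84 * e\<^sup>2 + 23\<close>
      is the remainder of \<open>r5'\<close> on division by \<open>r4'\<close>; 8 is the inverse of
      84 modulo 11.\<close>
    have "(e - 5) * (e + 5) = 8 * (84 * e\<^sup>2 + 23) - 11 * (61 * e\<^sup>2 + 19)"
      by algebra
    also have "84 * e\<^sup>2 + 23 = 0"
      using r4' r5' unfolding chi by algebra
    finally have "e = 5 \<or> e = -5"
      unfolding numeral_11 by (auto simp: eq_neg_iff_add_eq_0)
    then obtain s where s: "s \<in> {1, -1}" "e = s * 5"
      using that[of 1] that[of "-1"] by auto
    have "5 * (s * c) = 5 * d\<^sup>2"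
      using ce unfolding s by (simp add: mult_ac)
    hence "s * c = d\<^sup>2"
      by (simp add: numeral_eq_0_iff_11)
    \<comment> \<open>Since \<open>s\<close> is a sign, it is its own inverse.\<close>
    hence "c = s * d\<^sup>2"
      using s(1) by (auto simp flip: \<open>s * c = d\<^sup>2\<close>)
    thus ?thesis
      using s True False unfolding sextic_coeffs_def by blast
  next
    case nonsquare: False
    hence chi: "d ^ 5 = -1"
      by (rule not_is_square_power_5)
    \<comment> \<open>The same division with \<open>d ^ 5 = -1\<close> leaves
      \<open>86 * e\<^sup>2 - 23\<close>; 5 is the inverse of 86 modulo 11.\<close>
    have "(e - 4) * (e + 4) = 5 * (86 * e\<^sup>2 - 23) - 11 * (39 * e\<^sup>2 - 9)"
      by algebra
    also have "86 * e\<^sup>2 - 23 = 0"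
      using r4' r5' unfolding chi by algebra
    finally have "e = 4 \<or> e = -4"
      unfolding numeral_11 by (auto simp: eq_neg_iff_add_eq_0)
    then obtain s where s: "s \<in> {1, -1}" "e = s * 4"
      using that[of 1] that[of "-1"] by auto
    \<comment> \<open>3 is the inverse of 4 modulo 11, and 3 * 5 = 15 reduces to 4.\<close>
    have "s * c = 3 * (c * e) - 11 * (s * c)"
      unfolding s by algebra
    also have "\<dots> = 4 * d\<^sup>2 + 11 * (d\<^sup>2 - s * c)"
      unfolding ce by algebra
    finally have "s * c = 4 * d\<^sup>2"
      unfolding numeral_11 by simp
    hence "c = s * (4 * d\<^sup>2)"
      using s(1) by (auto simp flip: \<open>s * c = 4 * d\<^sup>2\<close>)
    thus ?thesis
      using s nonsquare unfolding sextic_coeffs_def by blast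
  qed
qed

section \<open>Sufficiency by computation with natural representatives\<close>

text \<open>Each field element is the image of one residue below 11, so injectivity reduces to
  distinct values modulo 11; finiteness gives surjectivity.\<close>

lemma permutation_polynomialI_nat:
  fixes f :: "'a poly"
  assumes "\<And>k. poly f (of_nat k) = of_nat (F k)"
    and "distinct (map (\<lambda>k. F k mod 11) [0..<11])"
  shows "permutation_polynomial f"
proof -
  have "inj (poly f)"
  proof (rule injI)
    fix x y
    assume eq: "poly f x = poly f y"
    obtain m n where m: "m < 11" "x = of_nat m" and n: "n < 11" "y = of_nat n"
      using exists_of_nat by metis
    have "F m mod 11 = F n mod 11"
      using eq by (simp add: m n assms(1) of_nat_eq_iff_cong_CHAR CHAR_11 cong_def)
    moreover have "inj_on (\<lambda>k. F k mod 11) {..<11}"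
      using assms(2) unfolding distinct_map set_upt atLeast0LessThan by blast
    ultimately have "m = n"
      using m(1) n(1) by (auto dest: inj_onD)
    thus "x = y"
      by (simp add: m n)
  qed
  thus ?thesis
    unfolding permutation_polynomial_def by (simp add: bij_def finite_UNIV_inj_surj)
qed

lemma permutation_polynomial_sextic_nat:
  assumes "sextic_distinct_mod_11 c d e"
  shows "permutation_polynomial [:0, of_nat e, of_nat d, of_nat c, 0, 0, 1 :: 'a:]"
  \<comment> \<open>The unfolded assumption fills the second premise, and unification with it
    determines \<open>F\<close>.\<close>
  using _ assms[unfolded sextic_distinct_mod_11_def]
  by (rule permutation_polynomialI_nat) (simp, algebra)

lemma minus_one_eq_of_nat: "(-1 :: 'a) = of_nat 10"
proof -
  have "of_nat 10 + (1 :: 'a) = 11"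
    by simp
  thus ?thesis
    unfolding numeral_11 by (metis add_eq_0_iff2)
qed

lemma sextic_coeffs_sufficient:
  fixes c d e :: 'a
  assumes "sextic_coeffs c d e"
  shows "permutation_polynomial [:0, e, d, c, 0, 0, 1:]"
proof -
  have sign: "\<exists>t\<in>{1, 10}. s = of_nat t" if "s \<in> {1, -1}" for s :: 'a
  proof -
    have "s = of_nat 1 \<or> s = of_nat 10"
      using that unfolding minus_one_eq_of_nat by simp
    thus ?thesis
      by blast
  qed
  obtain a where a: "a < 11" "d = of_nat a"
    using exists_of_nat[of d] by auto
  \<comment> \<open>This carries Euler's criterion for \<open>d\<close> over to its representative
    \<open>a\<close>.\<close>
  have a5: "d ^ 5 = of_nat n \<longleftrightarrow> a ^ 5 mod 11 = n mod 11" for n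
    unfolding a(2) of_nat_power[symmetric]
    by (simp only: of_nat_eq_iff_cong_CHAR CHAR_11 cong_def)
  from assms consider
      s where "s \<in> {1, -1}" "c = 0" "d = 0" "e = s * 2 \<or> e = s * 4"
    | s where "s \<in> {1, -1}" "d \<noteq> 0" "is_square d" "c = s * d\<^sup>2" "e = s * 5"
    | s where "s \<in> {1, -1}" "\<not> is_square d" "c = s * (4 * d\<^sup>2)" "e = s * 4"
    unfolding sextic_coeffs_def by blast
  thus ?thesis
  proof cases
    case 1
    then obtain t where t: "t \<in> {1, 10}" "s = of_nat t"
      using sign by blast
    obtain u :: nat where u: "u \<in> {2, 4}" "e = of_nat (t * u)"
      using 1(4) t(2) that[of 2] that[of 4] by auto
    have "sextic_distinct_mod_11 0 0 (t * u)"
      using sextic_distinct_mod_11_binomial t(1) u(1) by blast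
    from permutation_polynomial_sextic_nat[OF this] show ?thesis
      unfolding 1(2,3) u(2) by simp
  next
    case 2
    then obtain t where t: "t \<in> {1, 10}" "s = of_nat t"
      using sign by blast
    have "d ^ 5 = of_nat 1"
      using is_square_power_5[OF 2(3,2)] by simp
    hence "a ^ 5 mod 11 = 1"
      unfolding a5 by simp
    hence "sextic_distinct_mod_11 (t * a\<^sup>2) a (t * 5)"
      using sextic_distinct_mod_11_square t(1) a(1) by (metis atLeastLessThan_upt atLeastLessThan_iff le0)
    from permutation_polynomial_sextic_nat[OF this] show ?thesis
      unfolding 2(4,5) a(2) t(2) by simp
  next
    case 3
    then obtain t where t: "t \<in> {1, 10}" "s = of_nat t"
      using sign by blast
    have "d ^ 5 = of_nat 10"
      using not_is_square_power_5[OF 3(2)] by (simp only: minus_one_eq_of_nat)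
    hence "a ^ 5 mod 11 = 10"
      unfolding a5 by simp
    hence "sextic_distinct_mod_11 (t * (4 * a\<^sup>2)) a (t * 4)"
      using sextic_distinct_mod_11_nonsquare t(1) a(1) by (metis atLeastLessThan_upt atLeastLessThan_iff le0)
    from permutation_polynomial_sextic_nat[OF this] show ?thesis
      unfolding 3(3,4) a(2) t(2) by simp
  qed
qed

section \<open>The classification\<close>

lemma normalised_permutation_polynomial_6_iff:
  fixes f :: "'a poly"
  shows "permutation_polynomial f \<and> normalised_form f \<and> degree f = 6 \<longleftrightarrow>
    (\<exists>c d e. f = [:0, e, d, c, 0, 0, 1:] \<and> sextic_coeffs c d e)"
proof (intro iffI; (elim exE conjE)?)
  assume perm: "permutation_polynomial f" and norm: "normalised_form f" and deg: "degree f = 6"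
  define b c d e where "b = coeff f 4" "c = coeff f 3" "d = coeff f 2" "e = coeff f 1"
  \<comment> \<open>The coefficient at 5 vanishes by normalisation, as 11 does not divide 6.\<close>
  have "coeff f 0 = 0" "coeff f 5 = 0" "coeff f 6 = 1"
    using norm deg by (simp_all add: normalised_form_def CHAR_11 poly_0_coeff_0)
  moreover have "coeff f n = 0" if "n > 6" for n
    using that deg by (simp add: coeff_eq_0)
  ultimately have f: "f = [:0, e, d, c, b, 0, 1:]"
    unfolding b_c_d_e_def
    by (intro poly_eqI) (simp add: coeff_pCons numeral_eq_Suc split: nat.split)
  note rels = perm[unfolded f]
  have "f = [:0, e, d, c, 0, 0, 1:]"
    using f sextic_coeff_4_eq_0[OF rels] by simp
  moreover have "sextic_coeffs c d e"
    by (intro sextic_coeffs_necessary sextic_power_rel_3[OF rels] sextic_power_rel_4[OF rels] sextic_power_rel_5[OF rels])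
  ultimately show "\<exists>c d e. f = [:0, e, d, c, 0, 0, 1:] \<and> sextic_coeffs c d e"
    by blast
next
  fix c d e
  assume "f = [:0, e, d, c, 0, 0, 1:]" "sextic_coeffs c d e"
  thus "permutation_polynomial f \<and> normalised_form f \<and> degree f = 6"
    using sextic_coeffs_sufficient by (simp add: normalised_form_def numeral_eq_Suc)
qed

end

theorem theorem3p9:
  assumes "CARD('a) = 11"
  shows "{f :: 'a::{finite,field} poly. permutation_polynomial f \<and> normalised_form f \<and> degree f = 6} =
     {monom 1 6 + monom (s * 2) 1 | s. s \<in> {1, -1}} \<union>
     {monom 1 6 + monom (s * 4) 1 | s. s \<in> {1, -1}} \<union>
     {monom 1 6 + monom (s * a^2) 3 + monom a 2 + monom (s * 5) 1 | s a.
        s \<in> {1, -1} \<and> a \<noteq> 0 \<and> is_square a} \<union>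
     {monom 1 6 + monom (s * (4 * a^2)) 3 + monom a 2 + monom (s * 4) 1 | s a.
        s \<in> {1, -1} \<and> \<not> is_square a}"
proof -
  have monoms: "monom 1 6 + monom c 3 + monom d 2 + monom e 1 = [:0, e, d, c, 0, 0, 1:]"
    "monom 1 6 + monom e 1 = [:0, e, 0, 0, 0, 0, 1:]" for c d e :: 'a
    by (simp_all add: numeral_eq_Suc monom_Suc monom_0)
  show ?thesis
    unfolding normalised_permutation_polynomial_6_iff[OF assms] sextic_coeffs_def monoms
    by blast
qed

end
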